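(* Let $\mathrm{H}:\mathbf{Top}_0\to\mathbf{Set}$ be an R-subset system. Then $\mathbf{H}\text{-}\mathbf{Sob}$ is reflective in $\mathbf{Top}_0$. The functor $H^s:\mathbf{Top}_0\to\mathbf{H}\text{-}\mathbf{Sob}$ is a left adjoint to the inclusion functor $I:\mathbf{H}\text{-}\mathbf{Sob}\to\mathbf{Top}_0$, where for any continuous mapping $f:X\to Y$ in $\mathbf{Top}_0$, $H^s(X)=X^h=P_H(\mathrm{H}^d_c(X))$, $H^s(Y)=Y^h=P_H(\mathrm{H}^d_c(Y))$, and $H^s(f)=f^h:X^h\to Y^h$ is the unique continuous mapping such that $f^h\circ\eta_X^h=\eta_Y^h\circ f$. For each $A\in\mathrm{H}^d_c(X)$, $f^h(A)=\overline{f(A)}$.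
   Context: $\mathbf{Top}_0$ is the category of all $T_0$ spaces with continuous mappings. A subset $A$ of a space $X$ is irreducible if it is nonempty and whenever $A\subseteq F_1\cup F_2$ with $F_1,F_2$ closed in $X$, then $A\subseteq F_1$ or $A\subseteq F_2$. An R-subset system (irreducible subset system) is a covariant functor $\mathrm{H}:\mathbf{Top}_0\to\mathbf{Set}$ such that (i) for every $T_0$ space $X$, $\mathrm{H}(X)$ is a set of irreducible subsets of $X$ which contains all singletons $\{x\}$, $x\in X$; (ii) for every continuous mapping $f:X\to Y$ between $T_0$ spaces and every $A\in \mathrm{H}(X)$, $\mathrm{H}(f)(A)=f(A)\in \mathrm{H}(Y)$. A $T_0$ space $X$ is $\mathrm{H}$-sober if for every $A\in\mathrm{H}(X)$ there is a (necessarily unique) point $x\in X$ with $\overline{A}=\overline{\{x\}}$. $\mathbf{H}\text{-}\mathbf{Sob}$ is the category of all $\mathrm{H}$-sober spaces with continuous mappings. A subset $A$ of a $T_0$ space $X$ is $\mathrm{H}$-sober determined if for every continuous mapping $f:X\to Y$ to an $\mathrm{H}$-sober space $Y$ there exists a unique $y_A\in Y$ with $\overline{f(A)}=\overline{\{y_A\}}$. $\mathrm{H}^d_c(X)$ is the set of all closed $\mathrm{H}$-sober determined subsets of $X$. For a set $\mathcal G$ of subsets of $X$, $P_H(\mathcal G)$ is $\mathcal G$ with the lower Vietoris topology, which has the sets $\Diamond U=\{G\in\mathcal G:G\cap U\ne\emptyset\}$, $U$ open in $X$, as a subbase. The canonical mapping $\eta_X^h:X\to P_H(\mathrm{H}^d_c(X))$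 is $\eta_X^h(x)=\overline{\{x\}}$. *)

theory Defs
  imports "HOL-Analysis.Analysis"
begin

section \<open>Categories, functors, adjunctions\<close>

text \<open>
  Hom-sets are indexed by their endpoints and need not be disjoint; composition and the action
  of a functor on arrows therefore take the endpoints as arguments.
  \<open>Comp C X Y Z g f\<close> is \<open>g\<close> after \<open>f\<close>, for \<open>f : X \<rightarrow> Y\<close> and \<open>g : Y \<rightarrow> Z\<close>.
\<close>

record ('o, 'm) cat =
  Obj :: "'o set"
  Hom :: "'o \<Rightarrow> 'o \<Rightarrow> 'm set"
  Ident :: "'o \<Rightarrow> 'm"
  Comp :: "'o \<Rightarrow> 'o \<Rightarrow> 'o \<Rightarrow> 'm \<Rightarrow> 'm \<Rightarrow> 'm"

definition is_category :: "('o, 'm) cat \<Rightarrow> bool" where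
  "is_category C \<longleftrightarrow>
     (\<forall>X\<in>Obj C. Ident C X \<in> Hom C X X) \<and>
     (\<forall>X\<in>Obj C. \<forall>Y\<in>Obj C. \<forall>Z\<in>Obj C. \<forall>f\<in>Hom C X Y. \<forall>g\<in>Hom C Y Z.
        Comp C X Y Z g f \<in> Hom C X Z) \<and>
     (\<forall>X\<in>Obj C. \<forall>Y\<in>Obj C. \<forall>f\<in>Hom C X Y.
        Comp C X X Y f (Ident C X) = f \<and> Comp C X Y Y (Ident C Y) f = f) \<and>
     (\<forall>W\<in>Obj C. \<forall>X\<in>Obj C. \<forall>Y\<in>Obj C. \<forall>Z\<in>Obj C.
        \<forall>f\<in>Hom C W X. \<forall>g\<in>Hom C X Y. \<forall>h\<in>Hom C Y Z.
        Comp C W Y Z h (Comp C W X Y g f) = Comp C W X Z (Comp C X Y Z h g) f)"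

record ('o, 'm, 'p, 'n) cfunctor =
  Fobj :: "'o \<Rightarrow> 'p"
  Farr :: "'o \<Rightarrow> 'o \<Rightarrow> 'm \<Rightarrow> 'n"

definition is_functor ::
  "('o, 'm) cat \<Rightarrow> ('p, 'n) cat \<Rightarrow> ('o, 'm, 'p, 'n) cfunctor \<Rightarrow> bool" where
  "is_functor C D F \<longleftrightarrow>
     is_category C \<and> is_category D \<and>
     (\<forall>X\<in>Obj C. Fobj F X \<in> Obj D) \<and>
     (\<forall>X\<in>Obj C. \<forall>Y\<in>Obj C. \<forall>f\<in>Hom C X Y.
        Farr F X Y f \<in> Hom D (Fobj F X) (Fobj F Y)) \<and>
     (\<forall>X\<in>Obj C. Farr F X X (Ident C X) = Ident D (Fobj F X)) \<and>
     (\<forall>X\<in>Obj C. \<forall>Y\<in>Obj C. \<forall>Z\<in>Obj C. \<forall>f\<in>Hom C X Y. \<forall>g\<in>Hom C Y Z.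
        Farr F X Z (Comp C X Y Z g f) =
        Comp D (Fobj F X) (Fobj F Y) (Fobj F Z) (Farr F Y Z g) (Farr F X Y f))"

definition subcategory :: "('o, 'm) cat \<Rightarrow> ('o, 'm) cat \<Rightarrow> bool" where
  "subcategory A B \<longleftrightarrow>
     is_category A \<and> is_category B \<and> Obj A \<subseteq> Obj B \<and>
     (\<forall>X\<in>Obj A. \<forall>Y\<in>Obj A. Hom A X Y \<subseteq> Hom B X Y) \<and>
     (\<forall>X\<in>Obj A. Ident A X = Ident B X) \<and>
     (\<forall>X\<in>Obj A. \<forall>Y\<in>Obj A. \<forall>Z\<in>Obj A. \<forall>f\<in>Hom A X Y. \<forall>g\<in>Hom A Y Z.
        Comp A X Y Z g f = Comp B X Y Z g f)"

definition inclusion_functor :: "('o, 'm, 'o, 'm) cfunctor" where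
  "inclusion_functor = \<lparr>Fobj = (\<lambda>X. X), Farr = (\<lambda>X Y f. f)\<rparr>"

text \<open>Every object of the ambient category has a reflection arrow into the subcategory.\<close>

definition reflective :: "('o, 'm) cat \<Rightarrow> ('o, 'm) cat \<Rightarrow> bool" where
  "reflective A B \<longleftrightarrow>
     subcategory A B \<and>
     (\<forall>X\<in>Obj B. \<exists>R\<in>Obj A. \<exists>r\<in>Hom B X R.
        \<forall>Y\<in>Obj A. \<forall>f\<in>Hom B X Y. \<exists>!g. g \<in> Hom A R Y \<and> Comp B X R Y g r = f)"

text \<open>\<open>F : C \<rightarrow> D\<close> is left adjoint to \<open>G : D \<rightarrow> C\<close>: there are bijections
  \<open>D(F X, Y) \<cong> C(X, G Y)\<close>, natural in \<open>X\<close> and \<open>Y\<close>.\<close>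

definition left_adjoint ::
  "('o, 'm) cat \<Rightarrow> ('p, 'n) cat \<Rightarrow> ('o, 'm, 'p, 'n) cfunctor \<Rightarrow> ('p, 'n, 'o, 'm) cfunctor \<Rightarrow> bool"
where
  "left_adjoint C D F G \<longleftrightarrow>
     is_functor C D F \<and> is_functor D C G \<and>
     (\<exists>\<phi>.
       (\<forall>X\<in>Obj C. \<forall>Y\<in>Obj D.
          bij_betw (\<phi> X Y) (Hom D (Fobj F X) Y) (Hom C X (Fobj G Y))) \<and>
       (\<forall>X\<in>Obj C. \<forall>X'\<in>Obj C. \<forall>Y\<in>Obj D. \<forall>Y'\<in>Obj D.
          \<forall>h\<in>Hom C X' X. \<forall>k\<in>Hom D Y Y'. \<forall>g\<in>Hom D (Fobj F X) Y.
          \<phi> X' Y' (Comp D (Fobj F X') Y Y' k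
                     (Comp D (Fobj F X') (Fobj F X) Y g (Farr F X' X h))) =
          Comp C X' (Fobj G Y) (Fobj G Y') (Farr G Y Y' k)
            (Comp C X' X (Fobj G Y) (\<phi> X Y g) h)))"

text \<open>Arrows are functions made \<open>undefined\<close> outside their domain, so that equality of arrows is
  equality on the domain.\<close>

definition Set_cat :: "('a set, 'a \<Rightarrow> 'a) cat" where
  "Set_cat = \<lparr>Obj = UNIV, Hom = (\<lambda>A B. A \<rightarrow>\<^sub>E B), Ident = (\<lambda>A. \<lambda>x\<in>A. x),
              Comp = (\<lambda>A B C g f. compose A g f)\<rparr>"

section \<open>The universe of sets and the category of T0 spaces\<close>

text \<open>
  A subset system lives on all T0 spaces, and its reflection turns a space whose points are in
  a type into one whose points are sets of such points. As HOL types are not closed under this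
  step, the points of all spaces are taken from one type that plays the role of the universe of
  sets: \<open>small A\<close> says that the class \<open>A\<close> is a set, and \<open>as_point A\<close> is that set regarded as an
  element of the universe. Only extensionality, subsets and power sets are required, so the
  axioms hold for the universe of all sets of ZFC and for every Grothendieck universe.
\<close>

class set_universe =
  fixes small :: "'a set \<Rightarrow> bool"
    and as_point :: "'a set \<Rightarrow> 'a"
  assumes small_empty: "small {}"
    and small_subset: "small A \<Longrightarrow> B \<subseteq> A \<Longrightarrow> small B"
    and small_Pow: "small A \<Longrightarrow> small (as_point ` Pow A)"
    and as_point_inject: "small A \<Longrightarrow> small B \<Longrightarrow> as_point A = as_point B \<Longrightarrow> A = B"

definition Top0 :: "('u::set_universe topology, 'u \<Rightarrow> 'u) cat" where
  "Top0 = \<lparr>Obj = {X. small (topspace X) \<and> t0_space X},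
           Hom = (\<lambda>X Y. {f \<in> extensional (topspace X). continuous_map X Y f}),
           Ident = (\<lambda>X. \<lambda>x\<in>topspace X. x),
           Comp = (\<lambda>X Y Z g f. compose (topspace X) g f)\<rparr>"

section \<open>R-subset systems and H-sober spaces\<close>

definition irreducible_in :: "'a topology \<Rightarrow> 'a set \<Rightarrow> bool" where
  "irreducible_in X A \<longleftrightarrow>
     A \<subseteq> topspace X \<and> A \<noteq> {} \<and>
     (\<forall>F1 F2. closedin X F1 \<and> closedin X F2 \<and> A \<subseteq> F1 \<union> F2 \<longrightarrow> A \<subseteq> F1 \<or> A \<subseteq> F2)"

type_synonym 'u subset_functor = "('u topology, 'u \<Rightarrow> 'u, 'u set set, 'u set \<Rightarrow> 'u set) cfunctor"

definition R_subset_system :: "'u::set_universe subset_functor \<Rightarrow> bool" where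
  "R_subset_system H \<longleftrightarrow>
     is_functor Top0 Set_cat H \<and>
     (\<forall>X\<in>Obj Top0. (\<forall>A\<in>Fobj H X. irreducible_in X A) \<and> (\<forall>x\<in>topspace X. {x} \<in> Fobj H X)) \<and>
     (\<forall>X\<in>Obj Top0. \<forall>Y\<in>Obj Top0. \<forall>f\<in>Hom Top0 X Y. \<forall>A\<in>Fobj H X.
        Farr H X Y f A = f ` A \<and> f ` A \<in> Fobj H Y)"

definition H_sober :: "'u::set_universe subset_functor \<Rightarrow> 'u topology \<Rightarrow> bool" where
  "H_sober H X \<longleftrightarrow>
     X \<in> Obj Top0 \<and>
     (\<forall>A\<in>Fobj H X. \<exists>x\<in>topspace X. X closure_of A = X closure_of {x})"

definition HSob :: "'u::set_universe subset_functor \<Rightarrow> ('u topology, 'u \<Rightarrow> 'u) cat" where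
  "HSob H = Top0\<lparr>Obj := {X. H_sober H X}\<rparr>"

definition H_sober_determined ::
  "'u::set_universe subset_functor \<Rightarrow> 'u topology \<Rightarrow> 'u set \<Rightarrow> bool" where
  "H_sober_determined H X A \<longleftrightarrow>
     A \<subseteq> topspace X \<and>
     (\<forall>Y f. H_sober H Y \<and> continuous_map X Y f \<longrightarrow>
        (\<exists>!y. y \<in> topspace Y \<and> Y closure_of (f ` A) = Y closure_of {y}))"

definition Hdc :: "'u::set_universe subset_functor \<Rightarrow> 'u topology \<Rightarrow> 'u set set" where
  "Hdc H X = {A. closedin X A \<and> H_sober_determined H X A}"

section \<open>The lower Vietoris topology and the H-sobrification\<close>

definition Diamond :: "'a set set \<Rightarrow> 'a set \<Rightarrow> 'a set set" where
  "Diamond \<G> U = {G\<in>\<G>. G \<inter> U \<noteq> {}}"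

text \<open>A member \<open>G\<close> of \<open>\<G>\<close> occurs as the point \<open>as_point G\<close>. The whole space is the empty
  intersection of subbasic sets and has to be added to the generators.\<close>

definition PH :: "'u::set_universe topology \<Rightarrow> 'u set set \<Rightarrow> 'u topology" where
  "PH X \<G> = topology_generated_by
     (insert (as_point ` \<G>) {as_point ` Diamond \<G> U | U. openin X U})"

definition Hspace :: "'u::set_universe subset_functor \<Rightarrow> 'u topology \<Rightarrow> 'u topology" where
  "Hspace H X = PH X (Hdc H X)"

definition eta :: "'u::set_universe topology \<Rightarrow> 'u \<Rightarrow> 'u" where
  "eta X = (\<lambda>x\<in>topspace X. as_point (X closure_of {x}))"

definition is_Hmap :: "'u::set_universe subset_functor \<Rightarrow> 'u topology \<Rightarrow> 'u topology \<Rightarrow>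
    ('u \<Rightarrow> 'u) \<Rightarrow> ('u \<Rightarrow> 'u) \<Rightarrow> bool" where
  "is_Hmap H X Y f g \<longleftrightarrow>
     g \<in> Hom Top0 (Hspace H X) (Hspace H Y) \<and>
     Comp Top0 X (Hspace H X) (Hspace H Y) g (eta X) = Comp Top0 X Y (Hspace H Y) (eta Y) f"

definition Hs :: "'u::set_universe subset_functor \<Rightarrow>
    ('u topology, 'u \<Rightarrow> 'u, 'u topology, 'u \<Rightarrow> 'u) cfunctor" where
  "Hs H = \<lparr>Fobj = Hspace H, Farr = (\<lambda>X Y f. THE g. is_Hmap H X Y f g)\<rparr>"

end

theory Submission
  imports Defs
begin

text \<open>
  A closed set \<open>A\<close> of \<open>X\<close> is recorded by the open sets that it meets, and so is a point of the
  hyperspace \<open>PH X \<G>\<close>: when the members of \<open>\<G>\<close> are irreducible, the sets \<open>Diamond \<G> U\<close> are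
  closed under finite intersections and hence are all the open sets, so that \<open>U \<mapsto> Diamond \<G> U\<close>
  identifies the two topologies. Every equality of closures below is therefore checked by
  comparing the open sets that are met (\<open>closure_of_eq_iff_meets\<close>).

  For \<open>A\<close> in \<open>Hdc H X\<close> and \<open>f : X \<rightarrow> Y\<close> with \<open>Y\<close> \<open>H\<close>-sober, the generic point of \<open>f ` A\<close> is the only
  possible value at \<open>A\<close> of a continuous extension of \<open>f\<close> along \<open>eta X\<close>, because \<open>A\<close> itself is the
  generic point of \<open>eta X ` A\<close>; and these values do define a continuous map. This gives
  the universal property (\<open>eta_universal\<close>), once the hyperspace is known to be \<open>H\<close>-sober.

  Sobriety rests on one computation: a set \<open>S\<close> of points of \<open>PH X \<G>\<close> has as generic point the
  closure of the union of \<open>S\<close>, as soon as this closure belongs to \<open>\<G>\<close>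
  (\<open>closure_of_hyperspace_points\<close>). It is used twice. If \<open>\<G>\<close> consists of all closed irreducible sets
  and \<open>S\<close> is irreducible, the closed union is irreducible, so this \<open>PH X \<G>\<close> is \<open>H\<close>-sober for every \<open>H\<close>;
  mapping \<open>X\<close> into it shows that \<open>H\<close>-sober determined closed sets are irreducible. Therefore \<open>\<G>\<close> may
  be taken to be \<open>Hdc H X\<close>: for \<open>S\<close> in \<open>H\<close> of the hyperspace, the extension of \<open>f : X \<rightarrow> Y\<close> carries
  \<open>S\<close> to a member of \<open>H Y\<close>, whose generic point is also one for the image of the union of \<open>S\<close>;
  hence the closed union is again \<open>H\<close>-sober determined.

  Reflectivity and the adjunction then follow from the universal property alone.
\<close>

section \<open>Universal arrows into a subcategory\<close>

lemma subcategory_inclusion_functor: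
  assumes "subcategory A B"
  shows "is_functor A B inclusion_functor"
  using assms unfolding subcategory_def is_functor_def inclusion_functor_def by auto

lemma is_categoryD:
  assumes "is_category C"
  shows "X \<in> Obj C \<Longrightarrow> Ident C X \<in> Hom C X X"
    and "X \<in> Obj C \<Longrightarrow> Y \<in> Obj C \<Longrightarrow> Z \<in> Obj C \<Longrightarrow> f \<in> Hom C X Y \<Longrightarrow> g \<in> Hom C Y Z \<Longrightarrow>
      Comp C X Y Z g f \<in> Hom C X Z"
    and "X \<in> Obj C \<Longrightarrow> Y \<in> Obj C \<Longrightarrow> f \<in> Hom C X Y \<Longrightarrow> Comp C X X Y f (Ident C X) = f"
    and "X \<in> Obj C \<Longrightarrow> Y \<in> Obj C \<Longrightarrow> f \<in> Hom C X Y \<Longrightarrow> Comp C X Y Y (Ident C Y) f = f"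
    and "W \<in> Obj C \<Longrightarrow> X \<in> Obj C \<Longrightarrow> Y \<in> Obj C \<Longrightarrow> Z \<in> Obj C \<Longrightarrow>
      f \<in> Hom C W X \<Longrightarrow> g \<in> Hom C X Y \<Longrightarrow> h \<in> Hom C Y Z \<Longrightarrow>
      Comp C W Y Z h (Comp C W X Y g f) = Comp C W X Z (Comp C X Y Z h g) f"
  using assms unfolding is_category_def by simp_all

lemma subcategoryD:
  assumes "subcategory A B"
  shows "is_category A" and "is_category B"
    and "X \<in> Obj A \<Longrightarrow> X \<in> Obj B"
    and "X \<in> Obj A \<Longrightarrow> Y \<in> Obj A \<Longrightarrow> f \<in> Hom A X Y \<Longrightarrow> f \<in> Hom B X Y"
    and "X \<in> Obj A \<Longrightarrow> Ident A X = Ident B X"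
    and "X \<in> Obj A \<Longrightarrow> Y \<in> Obj A \<Longrightarrow> Z \<in> Obj A \<Longrightarrow> f \<in> Hom A X Y \<Longrightarrow> g \<in> Hom A Y Z \<Longrightarrow>
      Comp A X Y Z g f = Comp B X Y Z g f"
  using assms unfolding subcategory_def by blast+

lemma full_subcategory:
  assumes C: "is_category C" and "\<O> \<subseteq> Obj C"
  shows "subcategory (C\<lparr>Obj := \<O>\<rparr>) C"
proof -
  have "X \<in> Obj C" if "X \<in> \<O>" for X using that assms(2) by blast
  then have "is_category (C\<lparr>Obj := \<O>\<rparr>)"
    unfolding is_category_def by (auto intro: is_categoryD[OF C])
  then show ?thesis using assms by (simp add: subcategory_def)
qed

text \<open>The reflection as a family of universal arrows \<open>u\<close> together with a choice of maps between the
  reflections that makes \<open>u\<close> natural. Functoriality of this choice is a consequence of uniqueness in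
  the universal property.\<close>

locale universal_arrows =
  fixes A B :: "('o, 'm) cat" and F :: "('o, 'm, 'o, 'm) cfunctor" and u :: "'o \<Rightarrow> 'm"
  assumes subcat: "subcategory A B"
    and Fobj_in: "X \<in> Obj B \<Longrightarrow> Fobj F X \<in> Obj A"
    and u_in: "X \<in> Obj B \<Longrightarrow> u X \<in> Hom B X (Fobj F X)"
    and universal: "X \<in> Obj B \<Longrightarrow> Y \<in> Obj A \<Longrightarrow> f \<in> Hom B X Y \<Longrightarrow>
      \<exists>!g. g \<in> Hom A (Fobj F X) Y \<and> Comp B X (Fobj F X) Y g (u X) = f"
    and Farr_in: "X \<in> Obj B \<Longrightarrow> Y \<in> Obj B \<Longrightarrow> f \<in> Hom B X Y \<Longrightarrow>
      Farr F X Y f \<in> Hom A (Fobj F X) (Fobj F Y)"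
    and Farr_square: "X \<in> Obj B \<Longrightarrow> Y \<in> Obj B \<Longrightarrow> f \<in> Hom B X Y \<Longrightarrow>
      Comp B X (Fobj F X) (Fobj F Y) (Farr F X Y f) (u X) = Comp B X Y (Fobj F Y) (u Y) f"
begin

lemmas A_cat = is_categoryD[OF subcategoryD(1)[OF subcat]]
lemmas B_cat = is_categoryD[OF subcategoryD(2)[OF subcat]]
lemmas AB = subcategoryD(3-)[OF subcat]

lemma reflective: "reflective A B"
  unfolding reflective_def using subcat Fobj_in u_in universal by meson

lemma arrow_eqI:
  assumes "X \<in> Obj B" "Y \<in> Obj A" "g \<in> Hom A (Fobj F X) Y" "g' \<in> Hom A (Fobj F X) Y"
    and "Comp B X (Fobj F X) Y g (u X) = Comp B X (Fobj F X) Y g' (u X)"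
  shows "g = g'"
proof -
  have "Comp B X (Fobj F X) Y g (u X) \<in> Hom B X Y"
    using assms by (intro B_cat(2)) (auto intro: AB Fobj_in u_in)
  from universal[OF assms(1,2) this] show ?thesis using assms(3-5) by metis
qed

lemma Farr_functorial: "is_functor B A F"
proof -
  have id: "Farr F X X (Ident B X) = Ident A (Fobj F X)" if X: "X \<in> Obj B" for X
  proof (rule arrow_eqI[OF X Fobj_in[OF X]])
    show "Farr F X X (Ident B X) \<in> Hom A (Fobj F X) (Fobj F X)"
      using X by (simp add: Farr_in B_cat(1))
    show "Ident A (Fobj F X) \<in> Hom A (Fobj F X) (Fobj F X)"
      using X by (simp add: A_cat(1) Fobj_in)
    show "Comp B X (Fobj F X) (Fobj F X) (Farr F X X (Ident B X)) (u X) =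
      Comp B X (Fobj F X) (Fobj F X) (Ident A (Fobj F X)) (u X)"
      using X by (simp add: Farr_square B_cat AB(1,3) Fobj_in u_in)
  qed
  have comp: "Farr F X Z (Comp B X Y Z g f) =
      Comp A (Fobj F X) (Fobj F Y) (Fobj F Z) (Farr F Y Z g) (Farr F X Y f)"
    if X: "X \<in> Obj B" and Y: "Y \<in> Obj B" and Z: "Z \<in> Obj B"
      and f: "f \<in> Hom B X Y" and g: "g \<in> Hom B Y Z" for X Y Z f g
  proof (rule arrow_eqI[OF X Fobj_in[OF Z]])
    let ?FX = "Fobj F X" and ?FY = "Fobj F Y" and ?FZ = "Fobj F Z"
    let ?Ff = "Farr F X Y f" and ?Fg = "Farr F Y Z g"
    note obA = Fobj_in[OF X] Fobj_in[OF Y] Fobj_in[OF Z]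
    note ob = X Y Z obA[THEN AB(1)]
    note Ff = Farr_in[OF X Y f] and Fg = Farr_in[OF Y Z g]
    note Ff' = AB(2)[OF obA(1,2) Ff] and Fg' = AB(2)[OF obA(2,3) Fg]
    have gf: "Comp B X Y Z g f \<in> Hom B X Z" using ob f g by (intro B_cat(2))
    show "Farr F X Z (Comp B X Y Z g f) \<in> Hom A ?FX ?FZ" using X Z gf by (rule Farr_in)
    show "Comp A ?FX ?FY ?FZ ?Fg ?Ff \<in> Hom A ?FX ?FZ" using obA Ff Fg by (intro A_cat(2))
    have "Comp B X ?FX ?FZ (Comp A ?FX ?FY ?FZ ?Fg ?Ff) (u X)
        = Comp B X ?FX ?FZ (Comp B ?FX ?FY ?FZ ?Fg ?Ff) (u X)"
      by (simp add: AB(4)[OF obA Ff Fg])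
    also have "\<dots> = Comp B X ?FY ?FZ ?Fg (Comp B X ?FX ?FY ?Ff (u X))"
      using B_cat(5)[OF X ob(4-6) u_in[OF X] Ff' Fg'] by simp
    also have "\<dots> = Comp B X ?FY ?FZ ?Fg (Comp B X Y ?FY (u Y) f)"
      by (simp add: Farr_square[OF X Y f])
    also have "\<dots> = Comp B X Y ?FZ (Comp B Y ?FY ?FZ ?Fg (u Y)) f"
      using B_cat(5)[OF X Y ob(5,6) f u_in[OF Y] Fg'] by simp
    also have "\<dots> = Comp B X Y ?FZ (Comp B Y Z ?FZ (u Z) g) f"
      by (simp add: Farr_square[OF Y Z g])
    also have "\<dots> = Comp B X Z ?FZ (u Z) (Comp B X Y Z g f)"
      using B_cat(5)[OF X Y Z ob(6) f g u_in[OF Z]] by simp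
    also have "\<dots> = Comp B X ?FX ?FZ (Farr F X Z (Comp B X Y Z g f)) (u X)"
      by (simp add: Farr_square[OF X Z gf])
    finally show "Comp B X ?FX ?FZ (Farr F X Z (Comp B X Y Z g f)) (u X) =
      Comp B X ?FX ?FZ (Comp A ?FX ?FY ?FZ ?Fg ?Ff) (u X)" by simp
  qed
  show ?thesis
    unfolding is_functor_def
    using subcategoryD(1,2)[OF subcat] Fobj_in Farr_in id comp by simp
qed

text \<open>The adjunction bijection from \<open>A(F X, Y)\<close> to \<open>B(X, Y)\<close> is composition with the universal arrow; bijectivity is the
  universal property and naturality is associativity together with the naturality of \<open>u\<close>.\<close>

lemma left_adjoint: "left_adjoint B A F inclusion_functor"
proof -
  let ?\<phi> = "\<lambda>X Y g. Comp B X (Fobj F X) Y g (u X)"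
  have bij: "bij_betw (?\<phi> X Y) (Hom A (Fobj F X) Y) (Hom B X Y)"
    if X: "X \<in> Obj B" and Y: "Y \<in> Obj A" for X Y
    unfolding bij_betw_def
  proof (intro conjI equalityI subsetI)
    show "inj_on (?\<phi> X Y) (Hom A (Fobj F X) Y)"
      using arrow_eqI[OF X Y] by (auto simp: inj_on_def)
  next
    fix f assume "f \<in> ?\<phi> X Y ` Hom A (Fobj F X) Y"
    then show "f \<in> Hom B X Y"
      using X Y by (auto intro!: B_cat(2) intro: AB Fobj_in u_in)
  next
    fix f assume "f \<in> Hom B X Y"
    from universal[OF X Y this] show "f \<in> ?\<phi> X Y ` Hom A (Fobj F X) Y" by blast
  qed
  have nat: "?\<phi> X' Y' (Comp A (Fobj F X') Y Y' k
        (Comp A (Fobj F X') (Fobj F X) Y g (Farr F X' X h))) =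
      Comp B X' Y Y' k (Comp B X' X Y (?\<phi> X Y g) h)"
    if X: "X \<in> Obj B" and X': "X' \<in> Obj B" and Y: "Y \<in> Obj A" and Y': "Y' \<in> Obj A"
      and h: "h \<in> Hom B X' X" and k: "k \<in> Hom A Y Y'" and g: "g \<in> Hom A (Fobj F X) Y"
    for X X' Y Y' h k g
  proof -
    let ?FX = "Fobj F X" and ?FX' = "Fobj F X'" and ?Fh = "Farr F X' X h"
    note obA = Fobj_in[OF X] Fobj_in[OF X'] Y Y'
    note ob = obA[THEN AB(1)]
    note Fh = Farr_in[OF X' X h]
    note Fh' = AB(2)[OF obA(2,1) Fh] and g' = AB(2)[OF obA(1,3) g] and k' = AB(2)[OF Y Y' k]
    have gFh: "Comp A ?FX' ?FX Y g ?Fh = Comp B ?FX' ?FX Y g ?Fh"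
      using AB(4)[OF obA(2,1,3) Fh g] .
    have gFh_in: "Comp A ?FX' ?FX Y g ?Fh \<in> Hom A ?FX' Y"
      using obA Fh g by (intro A_cat(2))
    have "?\<phi> X' Y' (Comp A ?FX' Y Y' k (Comp A ?FX' ?FX Y g ?Fh))
        = Comp B X' ?FX' Y' (Comp B ?FX' Y Y' k (Comp A ?FX' ?FX Y g ?Fh)) (u X')"
      by (simp add: AB(4)[OF obA(2) Y Y' gFh_in k])
    also have "\<dots> = Comp B X' Y Y' k (Comp B X' ?FX' Y (Comp A ?FX' ?FX Y g ?Fh) (u X'))"
      using B_cat(5)[OF X' ob(2,3,4) u_in[OF X'] AB(2)[OF obA(2,3) gFh_in] k'] by simp
    also have "Comp B X' ?FX' Y (Comp A ?FX' ?FX Y g ?Fh) (u X')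
        = Comp B X' ?FX Y g (Comp B X' ?FX' ?FX ?Fh (u X'))"
      using B_cat(5)[OF X' ob(2,1,3) u_in[OF X'] Fh' g'] gFh by simp
    also have "\<dots> = Comp B X' ?FX Y g (Comp B X' X ?FX (u X) h)"
      by (simp add: Farr_square[OF X' X h])
    also have "\<dots> = Comp B X' X Y (?\<phi> X Y g) h"
      using B_cat(5)[OF X' X ob(1,3) h u_in[OF X] g'] by simp
    finally show ?thesis .
  qed
  show ?thesis
    unfolding left_adjoint_def
    using Farr_functorial subcategory_inclusion_functor[OF subcat] bij nat
    by (auto simp: inclusion_functor_def intro!: exI[of _ ?\<phi>])
qed

end

section \<open>Closures and irreducible sets\<close>

lemma closure_of_eq_iff_meets:
  "X closure_of S = X closure_of T \<longleftrightarrow> (\<forall>U. openin X U \<longrightarrow> S \<inter> U \<noteq> {} \<longleftrightarrow> T \<inter> U \<noteq> {})"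
proof
  assume "X closure_of S = X closure_of T"
  then show "\<forall>U. openin X U \<longrightarrow> S \<inter> U \<noteq> {} \<longleftrightarrow> T \<inter> U \<noteq> {}"
    using openin_Int_closure_of_eq_empty by (metis Int_commute)
next
  assume "\<forall>U. openin X U \<longrightarrow> S \<inter> U \<noteq> {} \<longleftrightarrow> T \<inter> U \<noteq> {}"
  then show "X closure_of S = X closure_of T"
    unfolding closure_of_def by blast
qed

lemma closure_of_meets_iff: "openin X U \<Longrightarrow> X closure_of S \<inter> U \<noteq> {} \<longleftrightarrow> S \<inter> U \<noteq> {}"
  using openin_Int_closure_of_eq_empty[of X U S] by (simp add: Int_commute)

lemma closure_of_image_cong:
  assumes f: "continuous_map X Y f" and "S \<subseteq> topspace X" "T \<subseteq> topspace X"
    and "X closure_of S = X closure_of T"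
  shows "Y closure_of (f ` S) = Y closure_of (f ` T)"
proof (unfold closure_of_eq_iff_meets, intro allI impI)
  fix V assume "openin Y V"
  then have U: "openin X {x \<in> topspace X. f x \<in> V}"
    by (rule openin_continuous_map_preimage[OF f])
  have "f ` R \<inter> V \<noteq> {} \<longleftrightarrow> R \<inter> {x \<in> topspace X. f x \<in> V} \<noteq> {}" if "R \<subseteq> topspace X" for R
    using that by blast
  with assms U show "f ` S \<inter> V \<noteq> {} \<longleftrightarrow> f ` T \<inter> V \<noteq> {}"
    by (simp add: closure_of_eq_iff_meets)
qed

lemma closure_of_image_closure_of:
  assumes "continuous_map X Y f" and "S \<subseteq> topspace X"
  shows "Y closure_of (f ` (X closure_of S)) = Y closure_of (f ` S)"
  using closure_of_image_cong[OF assms(1) closure_of_subset_topspace assms(2)] by simp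

lemma irreducible_inD:
  assumes "irreducible_in X A" "closedin X F1" "closedin X F2" "A \<subseteq> F1 \<union> F2"
  shows "A \<subseteq> F1 \<or> A \<subseteq> F2"
  using assms unfolding irreducible_in_def by blast

lemma irreducible_in_meets_Int:
  assumes "irreducible_in X A" "openin X U" "openin X V" "A \<inter> U \<noteq> {}" "A \<inter> V \<noteq> {}"
  shows "A \<inter> (U \<inter> V) \<noteq> {}"
proof
  assume "A \<inter> (U \<inter> V) = {}"
  then have "A \<subseteq> (topspace X - U) \<union> (topspace X - V)"
    using assms(1) by (auto simp: irreducible_in_def)
  then have "A \<subseteq> topspace X - U \<or> A \<subseteq> topspace X - V"
    using assms(1-3) by (intro irreducible_inD) auto
  then show False using assms(4,5) by blast
qed

lemma irreducible_in_closure_of_singleton: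
  assumes "x \<in> topspace X"
  shows "irreducible_in X (X closure_of {x})"
  unfolding irreducible_in_def
proof (intro conjI allI impI)
  show "X closure_of {x} \<subseteq> topspace X" by (rule closure_of_subset_topspace)
  have x: "x \<in> X closure_of {x}" using assms by (simp add: in_closure_of)
  then show "X closure_of {x} \<noteq> {}" by blast
  fix F1 F2 assume F: "closedin X F1 \<and> closedin X F2 \<and> X closure_of {x} \<subseteq> F1 \<union> F2"
  with x have "x \<in> F1 \<or> x \<in> F2" by blast
  then show "X closure_of {x} \<subseteq> F1 \<or> X closure_of {x} \<subseteq> F2"
    using F closure_of_minimal[of "{x}" F1 X] closure_of_minimal[of "{x}" F2 X] by blast
qed

section \<open>Spaces of the universe\<close>

lemma Top0_simps [simp]:
  "X \<in> Obj Top0 \<longleftrightarrow> small (topspace X) \<and> t0_space X"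
  "f \<in> Hom Top0 X Y \<longleftrightarrow> f \<in> extensional (topspace X) \<and> continuous_map X Y f"
  "Ident Top0 X = (\<lambda>x\<in>topspace X. x)"
  "Comp Top0 X Y Z g f = compose (topspace X) g f"
  by (simp_all add: Top0_def)

lemma HSob_simps [simp]:
  "X \<in> Obj (HSob H) \<longleftrightarrow> H_sober H X"
  "Hom (HSob H) = Hom Top0"
  "Ident (HSob H) = Ident Top0"
  "Comp (HSob H) = Comp Top0"
  by (simp_all add: HSob_def)

lemma continuous_map_restrict_topspace:
  "continuous_map X Y f \<Longrightarrow> continuous_map X Y (restrict f (topspace X))"
  by (rule continuous_map_eq) auto

lemma continuous_map_compose_topspace:
  "continuous_map X Y f \<Longrightarrow> continuous_map Y Z g \<Longrightarrow> continuous_map X Z (compose (topspace X) g f)"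
  unfolding compose_def
  by (rule continuous_map_restrict_topspace) (use continuous_map_compose[of X Y f Z g] in \<open>simp add: o_def\<close>)

lemma is_category_Top0: "is_category (Top0 :: ('u::set_universe topology, 'u \<Rightarrow> 'u) cat)"
  unfolding is_category_def Top0_simps
proof (intro conjI ballI)
  fix X Y :: "'u topology" and f
  assume "f \<in> Hom Top0 X Y"
  then have f: "f \<in> extensional (topspace X)" "continuous_map X Y f" by simp_all
  then have "f \<in> topspace X \<rightarrow> topspace Y" by (simp add: continuous_map_funspace)
  with f show "compose (topspace X) f (\<lambda>x\<in>topspace X. x) = f"
    and "compose (topspace X) (\<lambda>x\<in>topspace Y. x) f = f"
    by (auto simp: compose_Id Id_compose)
next
  fix W X :: "'u topology" and f g h :: "'u \<Rightarrow> 'u"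
  assume "f \<in> Hom Top0 W X"
  then show "compose (topspace W) h (compose (topspace W) g f) =
      compose (topspace W) (compose (topspace X) h g) f"
    by (intro compose_assoc[OF continuous_map_funspace]) simp
qed (auto simp: continuous_map_compose_topspace continuous_map_restrict_topspace[of _ _ "\<lambda>x. x"])

lemma subcategory_HSob: "subcategory (HSob H) Top0"
  unfolding HSob_def
  by (rule full_subcategory[OF is_category_Top0]) (auto simp: H_sober_def)

lemma generic_point_unique:
  assumes "t0_space Y" "y \<in> topspace Y" "y' \<in> topspace Y"
    and "Y closure_of {y} = Y closure_of {y'}"
  shows "y = y'"
  using assms by (auto simp: t0_space_closure_of_sing)

text \<open>Points of a \<open>T\<^sub>0\<close> space are determined by their closures.\<close>

lemma H_sober_determined_iff:
  "H_sober_determined H X A \<longleftrightarrow> A \<subseteq> topspace X \<and>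
    (\<forall>Y f. H_sober H Y \<and> continuous_map X Y f \<longrightarrow>
      (\<exists>y\<in>topspace Y. Y closure_of (f ` A) = Y closure_of {y}))"
proof -
  have "(\<exists>!y. y \<in> topspace Y \<and> Y closure_of (f ` A) = Y closure_of {y}) \<longleftrightarrow>
      (\<exists>y\<in>topspace Y. Y closure_of (f ` A) = Y closure_of {y})" if "H_sober H Y" for Y f
    using that generic_point_unique[of Y] by (auto simp: H_sober_def)
  then show ?thesis unfolding H_sober_determined_def by (simp cong: imp_cong)
qed

lemma R_subset_systemD:
  assumes "R_subset_system H" "X \<in> Obj Top0"
  shows "A \<in> Fobj H X \<Longrightarrow> irreducible_in X A"
    and "Y \<in> Obj Top0 \<Longrightarrow> continuous_map X Y f \<Longrightarrow> A \<in> Fobj H X \<Longrightarrow> f ` A \<in> Fobj H Y"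
proof -
  show irr: "irreducible_in X A" if "A \<in> Fobj H X"
    using assms that unfolding R_subset_system_def by blast
  assume A: "A \<in> Fobj H X" and Y: "Y \<in> Obj Top0" and f: "continuous_map X Y f"
  have "restrict f (topspace X) \<in> Hom Top0 X Y"
    using f by (simp add: continuous_map_restrict_topspace)
  then have "restrict f (topspace X) ` A \<in> Fobj H Y"
    using assms A Y unfolding R_subset_system_def by blast
  moreover have "restrict f (topspace X) ` A = f ` A"
    using irr[OF A] by (auto simp: irreducible_in_def intro!: image_cong)
  ultimately show "f ` A \<in> Fobj H Y" by simp
qed

section \<open>Hyperspaces of closed irreducible sets\<close>

locale irreducible_hyperspace =
  fixes X :: "'u::set_universe topology" and \<G> :: "'u set set"
  assumes X: "X \<in> Obj Top0"
    and closed: "G \<in> \<G> \<Longrightarrow> closedin X G"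
    and irred: "G \<in> \<G> \<Longrightarrow> irreducible_in X G"
begin

lemma sub_topspace: "G \<in> \<G> \<Longrightarrow> G \<subseteq> topspace X"
  using closed closedin_subset by blast

lemma as_point_inj: "inj_on as_point \<G>"
proof (rule inj_onI)
  fix G G' assume "G \<in> \<G>" "G' \<in> \<G>" "as_point G = as_point G'"
  moreover have "small K" if "K \<in> \<G>" for K
    using X small_subset[OF _ sub_topspace[OF that]] by simp
  ultimately show "G = G'" using as_point_inject by blast
qed

lemma topspace_PH [simp]: "topspace (PH X \<G>) = as_point ` \<G>"
  unfolding PH_def by (auto simp: Diamond_def)

lemma as_point_in_Diamond_iff:
  "G \<in> \<G> \<Longrightarrow> as_point G \<in> as_point ` Diamond \<G> U \<longleftrightarrow> G \<inter> U \<noteq> {}"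
  using as_point_inj by (auto simp: Diamond_def dest: inj_onD)

text \<open>Irreducibility is what makes the subbase closed under binary intersections; nonemptiness
  makes the whole space one of its members.\<close>

lemma openin_PH_iff: "openin (PH X \<G>) W \<longleftrightarrow> (\<exists>U. openin X U \<and> W = as_point ` Diamond \<G> U)"
proof
  assume "openin (PH X \<G>) W"
  then have "generate_topology_on
      (insert (as_point ` \<G>) {as_point ` Diamond \<G> U | U. openin X U}) W"
    by (simp add: PH_def openin_topology_generated_by_iff)
  then show "\<exists>U. openin X U \<and> W = as_point ` Diamond \<G> U"
  proof induction
    case Empty
    have "openin X {} \<and> {} = as_point ` Diamond \<G> {}" by (simp add: Diamond_def)
    then show ?case by blast
  next
    case (Int a b)
    then obtain U V where U: "openin X U" "a = as_point ` Diamond \<G> U"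
      and V: "openin X V" "b = as_point ` Diamond \<G> V" by blast
    have "a \<inter> b = as_point ` (Diamond \<G> U \<inter> Diamond \<G> V)"
      unfolding U V by (rule inj_on_image_Int[OF as_point_inj, symmetric]) (auto simp: Diamond_def)
    also have "Diamond \<G> U \<inter> Diamond \<G> V = Diamond \<G> (U \<inter> V)"
      using irreducible_in_meets_Int[OF irred U(1) V(1)] by (auto simp: Diamond_def)
    finally show ?case using U(1) V(1) by blast
  next
    case (UN K)
    let ?\<U> = "{U. openin X U \<and> as_point ` Diamond \<G> U \<in> K}"
    have "\<Union>K = (\<Union>U\<in>?\<U>. as_point ` Diamond \<G> U)"
    proof (intro equalityI subsetI)
      fix p assume "p \<in> \<Union>K"
      then obtain W where W: "W \<in> K" "p \<in> W" by blast
      from UN.IH[OF W(1)] obtain U where "openin X U" "W = as_point ` Diamond \<G> U" by blast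
      with W show "p \<in> (\<Union>U\<in>?\<U>. as_point ` Diamond \<G> U)" by blast
    qed auto
    also have "\<dots> = as_point ` (\<Union>U\<in>?\<U>. Diamond \<G> U)"
      by (simp only: image_UN)
    also have "(\<Union>U\<in>?\<U>. Diamond \<G> U) = Diamond \<G> (\<Union>?\<U>)"
      by (auto simp: Diamond_def)
    finally have "\<Union>K = as_point ` Diamond \<G> (\<Union>?\<U>)" .
    moreover have "openin X (\<Union>?\<U>)" by blast
    ultimately show ?case by blast
  next
    case (Basis W)
    have "G \<inter> topspace X \<noteq> {}" if "G \<in> \<G>" for G
      using irred[OF that] by (auto simp: irreducible_in_def)
    then have "Diamond \<G> (topspace X) = \<G>"
      by (auto simp: Diamond_def)
    then have "as_point ` \<G> = as_point ` Diamond \<G> (topspace X)" by simp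
    with Basis show ?case by blast
  qed
next
  assume "\<exists>U. openin X U \<and> W = as_point ` Diamond \<G> U"
  then show "openin (PH X \<G>) W"
    unfolding PH_def by (auto intro!: topology_generated_by_Basis)
qed

text \<open>Two closed sets are told apart by the complement of one of them.\<close>

lemma PH_in_Top0: "PH X \<G> \<in> Obj Top0"
proof -
  have "as_point ` \<G> \<subseteq> as_point ` Pow (topspace X)"
    using sub_topspace by blast
  then have "small (as_point ` \<G>)"
    using small_subset[OF small_Pow[of "topspace X"]] X by simp
  moreover have "t0_space (PH X \<G>)"
    unfolding t0_space_def
  proof (intro ballI impI)
    fix p q assume "p \<in> topspace (PH X \<G>)" "q \<in> topspace (PH X \<G>)" "p \<noteq> q"
    then obtain G K where G: "G \<in> \<G>" "p = as_point G" and K: "K \<in> \<G>" "q = as_point K"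
      and "G \<noteq> K" by auto
    then have "G \<inter> (topspace X - K) \<noteq> {} \<or> K \<inter> (topspace X - G) \<noteq> {}"
      using sub_topspace by blast
    then obtain L where L: "L \<in> \<G>"
      and sep: "G \<inter> (topspace X - L) \<noteq> {} \<longleftrightarrow> K \<inter> (topspace X - L) = {}"
      using G(1) K(1) by blast
    have "openin (PH X \<G>) (as_point ` Diamond \<G> (topspace X - L))"
      unfolding openin_PH_iff using closed[OF L] by blast
    then show "\<exists>W. openin (PH X \<G>) W \<and> (p \<notin> W \<longleftrightarrow> q \<in> W)"
      using sep G K by (metis as_point_in_Diamond_iff)
  qed
  ultimately show ?thesis by simp
qed

text \<open>Under \<open>U \<mapsto> Diamond \<G> U\<close>, a set of points of the hyperspace meets the same open sets as its
  union. Hence the closed union is its generic point.\<close>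

lemma hyperspace_points_meet_iff:
  "\<S> \<subseteq> \<G> \<Longrightarrow> as_point ` \<S> \<inter> as_point ` Diamond \<G> U \<noteq> {} \<longleftrightarrow> \<Union>\<S> \<inter> U \<noteq> {}"
proof -
  assume S: "\<S> \<subseteq> \<G>"
  have "as_point ` \<S> \<inter> as_point ` Diamond \<G> U \<noteq> {} \<longleftrightarrow>
      (\<exists>G\<in>\<S>. as_point G \<in> as_point ` Diamond \<G> U)" by blast
  also have "\<dots> \<longleftrightarrow> (\<exists>G\<in>\<S>. G \<inter> U \<noteq> {})"
    using S by (intro bex_cong as_point_in_Diamond_iff) auto
  finally show ?thesis by blast
qed

lemma closure_of_points_eq_iff:
  assumes "\<S> \<subseteq> \<G>" "\<T> \<subseteq> \<G>"
  shows "PH X \<G> closure_of (as_point ` \<S>) = PH X \<G> closure_of (as_point ` \<T>) \<longleftrightarrow>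
    X closure_of \<Union>\<S> = X closure_of \<Union>\<T>"
  unfolding closure_of_eq_iff_meets openin_PH_iff
  using hyperspace_points_meet_iff[OF assms(1)] hyperspace_points_meet_iff[OF assms(2)] by metis

lemma closure_of_hyperspace_points:
  assumes "\<S> \<subseteq> \<G>" "X closure_of \<Union>\<S> \<in> \<G>"
  shows "PH X \<G> closure_of (as_point ` \<S>) = PH X \<G> closure_of {as_point (X closure_of \<Union>\<S>)}"
  using closure_of_points_eq_iff[of \<S> "{X closure_of \<Union>\<S>}"] assms by simp

lemma subset_PH_cases:
  assumes "S \<subseteq> topspace (PH X \<G>)"
  obtains \<S> where "\<S> \<subseteq> \<G>" "S = as_point ` \<S>"
  using assms by (auto simp: subset_image_iff)

text \<open>For closed \<open>F\<close>, the members of \<open>\<G>\<close> inside \<open>F\<close> form a closed set of the hyperspace. A cover of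
  \<open>\<Union>\<S>\<close> by two closed sets thus yields a cover of \<open>\<S>\<close> by two closed sets: irreducibility of each
  member places it inside one of them, and irreducibility of \<open>\<S>\<close> makes the choice uniform.\<close>

lemma irreducible_Union:
  assumes "\<S> \<subseteq> \<G>" and irrS: "irreducible_in (PH X \<G>) (as_point ` \<S>)"
  shows "irreducible_in X (X closure_of \<Union>\<S>)"
  unfolding irreducible_in_def
proof (intro conjI allI impI)
  have sub: "\<Union>\<S> \<subseteq> topspace X" using assms(1) sub_topspace by blast
  then have subcl: "\<Union>\<S> \<subseteq> X closure_of \<Union>\<S>" by (rule closure_of_subset)
  show "X closure_of \<Union>\<S> \<subseteq> topspace X" by (rule closure_of_subset_topspace)
  from irrS obtain G where "G \<in> \<S>" by (auto simp: irreducible_in_def)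
  moreover from this have "G \<noteq> {}" using assms(1) irred by (auto simp: irreducible_in_def)
  ultimately show "X closure_of \<Union>\<S> \<noteq> {}" using subcl by blast
  fix F1 F2 assume F: "closedin X F1 \<and> closedin X F2 \<and> X closure_of \<Union>\<S> \<subseteq> F1 \<union> F2"
  let ?B = "\<lambda>F. as_point ` \<G> - as_point ` Diamond \<G> (topspace X - F)"
  have closedB: "closedin (PH X \<G>) (?B F)" if "closedin X F" for F
  proof -
    have "openin X (topspace X - F)" using that by (rule openin_diff[OF openin_topspace])
    then have "openin (PH X \<G>) (as_point ` Diamond \<G> (topspace X - F))"
      unfolding openin_PH_iff by blast
    then show ?thesis using closedin_diff[OF closedin_topspace, of "PH X \<G>"] by simp
  qed
  have inB: "as_point G \<in> ?B F \<longleftrightarrow> G \<subseteq> F" if "G \<in> \<S>" for G F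
    using that assms(1) as_point_in_Diamond_iff[of G] sub_topspace[of G] by blast
  have "as_point ` \<S> \<subseteq> ?B F1 \<union> ?B F2"
  proof
    fix p assume "p \<in> as_point ` \<S>"
    then obtain G where G: "G \<in> \<S>" "p = as_point G" by blast
    then have "G \<subseteq> F1 \<union> F2" using F subcl by blast
    then have "G \<subseteq> F1 \<or> G \<subseteq> F2"
      using F G(1) assms(1) by (intro irreducible_inD[OF irred]) auto
    then show "p \<in> ?B F1 \<union> ?B F2" unfolding Un_iff G(2) inB[OF G(1)] .
  qed
  then have "as_point ` \<S> \<subseteq> ?B F1 \<or> as_point ` \<S> \<subseteq> ?B F2"
    using F by (intro irreducible_inD[OF irrS] closedB) simp_all
  moreover have "\<Union>\<S> \<subseteq> F" if "as_point ` \<S> \<subseteq> ?B F" for F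
  proof (rule Union_least)
    fix G assume G: "G \<in> \<S>"
    then have "as_point G \<in> ?B F" using that by blast
    then show "G \<subseteq> F" unfolding inB[OF G] .
  qed
  ultimately have "\<Union>\<S> \<subseteq> F1 \<or> \<Union>\<S> \<subseteq> F2" by meson
  then show "X closure_of \<Union>\<S> \<subseteq> F1 \<or> X closure_of \<Union>\<S> \<subseteq> F2"
    using F closure_of_minimal[of _ F1 X] closure_of_minimal[of _ F2 X] by blast
qed

end

locale pointed_hyperspace = irreducible_hyperspace +
  assumes point_closure: "x \<in> topspace X \<Longrightarrow> X closure_of {x} \<in> \<G>"
begin

lemma eta_apply: "x \<in> topspace X \<Longrightarrow> eta X x = as_point (X closure_of {x})"
  by (simp add: eta_def)

lemma eta_in_Diamond_iff:
  assumes "x \<in> topspace X" "openin X U"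
  shows "eta X x \<in> as_point ` Diamond \<G> U \<longleftrightarrow> x \<in> U"
  using assms closure_of_meets_iff[of X U "{x}"]
  by (simp add: eta_apply as_point_in_Diamond_iff point_closure)

lemma eta_continuous: "continuous_map X (PH X \<G>) (eta X)"
proof (unfold continuous_map_def, intro conjI allI impI)
  show "eta X \<in> topspace X \<rightarrow> topspace (PH X \<G>)"
    using point_closure by (auto simp: eta_apply)
  fix W assume "openin (PH X \<G>) W"
  then obtain U where U: "openin X U" "W = as_point ` Diamond \<G> U"
    by (auto simp: openin_PH_iff)
  then have "{x \<in> topspace X. eta X x \<in> W} = U"
    using eta_in_Diamond_iff[OF _ U(1)] openin_subset[OF U(1)] by blast
  with U(1) show "openin X {x \<in> topspace X. eta X x \<in> W}" by simp
qed

text \<open>The image of \<open>S\<close> consists of the point closures, whose union has the same closure as \<open>S\<close>.\<close>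

lemma closure_of_eta_image:
  assumes "S \<subseteq> topspace X" "G \<in> \<G>"
  shows "PH X \<G> closure_of (eta X ` S) = PH X \<G> closure_of {as_point G} \<longleftrightarrow>
    X closure_of S = G"
proof -
  let ?\<S> = "(\<lambda>x. X closure_of {x}) ` S"
  have img: "eta X ` S = as_point ` ?\<S>"
    using assms(1) by (force simp: eta_apply)
  have "X closure_of \<Union>?\<S> = X closure_of S"
    unfolding closure_of_eq_iff_meets
  proof (intro allI impI)
    fix U assume "openin X U"
    then show "\<Union>?\<S> \<inter> U \<noteq> {} \<longleftrightarrow> S \<inter> U \<noteq> {}"
      using closure_of_meets_iff[of X U "{x}" for x] by blast
  qed
  moreover have "?\<S> \<subseteq> \<G>" using assms(1) point_closure by blast
  moreover have "X closure_of G = G" using closed[OF assms(2)] by (simp add: closure_of_eq)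
  ultimately show ?thesis
    using closure_of_points_eq_iff[of ?\<S> "{G}"] assms(2) img by simp
qed

end

section \<open>Determined closed sets are irreducible\<close>

lemma pointed_hyperspace_irreducible:
  assumes "X \<in> Obj Top0"
  shows "pointed_hyperspace X {G. closedin X G \<and> irreducible_in X G}"
  using assms by unfold_locales (auto simp: irreducible_in_closure_of_singleton)

text \<open>This hyperspace is the sobrification of \<open>X\<close>. It is \<open>H\<close>-sober because \<open>H\<close> selects irreducible
  sets only.\<close>

lemma H_sober_irreducible_hyperspace:
  fixes X :: "'u::set_universe topology"
  assumes H: "R_subset_system H" and X: "X \<in> Obj Top0"
  shows "H_sober H (PH X {G. closedin X G \<and> irreducible_in X G})"
proof -
  let ?G = "{G. closedin X G \<and> irreducible_in X G}"
  interpret pointed_hyperspace X ?G by (rule pointed_hyperspace_irreducible[OF X])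
  have "\<exists>p\<in>topspace (PH X ?G). PH X ?G closure_of S = PH X ?G closure_of {p}"
    if S: "S \<in> Fobj H (PH X ?G)" for S
  proof -
    have irrS: "irreducible_in (PH X ?G) S"
      using R_subset_systemD(1)[OF H PH_in_Top0 S] .
    then have "S \<subseteq> topspace (PH X ?G)" by (simp only: irreducible_in_def)
    then obtain \<S> where \<S>: "\<S> \<subseteq> ?G" "S = as_point ` \<S>"
      by (rule subset_PH_cases)
    have "X closure_of \<Union>\<S> \<in> ?G"
      using irreducible_Union[OF \<S>(1)] irrS \<S>(2) by simp
    then show ?thesis
      unfolding topspace_PH \<S>(2) using closure_of_hyperspace_points[OF \<S>(1)] by blast
  qed
  then show ?thesis unfolding H_sober_def using PH_in_Top0 by blast
qed

lemma Hdc_irreducible: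
  assumes H: "R_subset_system H" and X: "X \<in> Obj Top0" and A: "A \<in> Hdc H X"
  shows "irreducible_in X A"
proof -
  let ?G = "{G. closedin X G \<and> irreducible_in X G}"
  interpret pointed_hyperspace X ?G by (rule pointed_hyperspace_irreducible[OF X])
  have A': "closedin X A" "A \<subseteq> topspace X"
    using A closedin_subset by (auto simp: Hdc_def)
  obtain p where "p \<in> topspace (PH X ?G)" "PH X ?G closure_of (eta X ` A) = PH X ?G closure_of {p}"
    using A H_sober_irreducible_hyperspace[OF H X] eta_continuous
    unfolding Hdc_def H_sober_determined_iff by blast
  then obtain G where "G \<in> ?G" "X closure_of A = G"
    using closure_of_eta_image[OF A'(2)] by auto
  moreover have "X closure_of A = A" using A'(1) by (simp add: closure_of_eq)
  ultimately show ?thesis by simp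
qed

section \<open>The H-sobrification and its universal property\<close>

lemma closure_of_singleton_in_Hdc:
  assumes "x \<in> topspace X"
  shows "X closure_of {x} \<in> Hdc H X"
  unfolding Hdc_def H_sober_determined_iff
proof (intro CollectI conjI allI impI)
  show "closedin X (X closure_of {x})" by simp
  show "X closure_of {x} \<subseteq> topspace X" by (rule closure_of_subset_topspace)
  fix Y f assume "H_sober H Y \<and> continuous_map X Y f"
  then have f: "continuous_map X Y f" by simp
  then have "f x \<in> topspace Y" using assms by (auto dest: continuous_map_funspace)
  moreover have "Y closure_of (f ` (X closure_of {x})) = Y closure_of {f x}"
    using closure_of_image_closure_of[OF f, of "{x}"] assms by simp
  ultimately show "\<exists>y\<in>topspace Y. Y closure_of (f ` (X closure_of {x})) = Y closure_of {y}" by blast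
qed

text \<open>A map from \<open>Y\<close> to an \<open>H\<close>-sober space can be composed with \<open>f\<close> and tested on \<open>A\<close>. This makes the
  value \<open>Y closure_of (f ` A)\<close> of the reflected map a point of \<open>Hspace H Y\<close>.\<close>

lemma closure_of_image_in_Hdc:
  assumes f: "continuous_map X Y f" and A: "A \<in> Hdc H X"
  shows "Y closure_of (f ` A) \<in> Hdc H Y"
  unfolding Hdc_def H_sober_determined_iff
proof (intro CollectI conjI allI impI)
  show "closedin Y (Y closure_of (f ` A))" by simp
  show "Y closure_of (f ` A) \<subseteq> topspace Y" by (rule closure_of_subset_topspace)
  fix Z k assume "H_sober H Z \<and> continuous_map Y Z k"
  then have Z: "H_sober H Z" and k: "continuous_map Y Z k" by auto
  have "continuous_map X Z (k \<circ> f)" using f k by (rule continuous_map_compose)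
  then obtain z where z: "z \<in> topspace Z" "Z closure_of ((k \<circ> f) ` A) = Z closure_of {z}"
    using A Z unfolding Hdc_def H_sober_determined_iff by blast
  have "f ` A \<subseteq> topspace Y"
    using A f unfolding Hdc_def H_sober_determined_iff by (auto dest: continuous_map_funspace)
  then have "Z closure_of (k ` (Y closure_of (f ` A))) = Z closure_of ((k \<circ> f) ` A)"
    using closure_of_image_closure_of[OF k] by (simp add: image_comp)
  with z show "\<exists>z\<in>topspace Z. Z closure_of (k ` (Y closure_of (f ` A))) = Z closure_of {z}" by auto
qed

locale H_sobrification =
  fixes H :: "'u::set_universe subset_functor" and X :: "'u topology"
  assumes H: "R_subset_system H" and X_Top0: "X \<in> Obj Top0"

sublocale H_sobrification \<subseteq> pointed_hyperspace X "Hdc H X"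
  by unfold_locales
    (use X_Top0 Hdc_irreducible[OF H X_Top0] closure_of_singleton_in_Hdc in \<open>auto simp: Hdc_def\<close>)

context H_sobrification
begin

lemma Hspace_eq: "Hspace H X = PH X (Hdc H X)"
  by (simp add: Hspace_def)

text \<open>The extension sends \<open>A\<close> to the generic point of \<open>f ` A\<close>; it extends \<open>f\<close> because \<open>f x\<close> is the generic
  point of the image of the closure of \<open>x\<close>. It is continuous since it takes \<open>A\<close> into \<open>V\<close> exactly when \<open>A\<close> meets the preimage of \<open>V\<close>
  under \<open>f\<close>.\<close>

lemma extension_exists:
  assumes Y: "H_sober H Y" and f: "continuous_map X Y f"
  obtains g where "g \<in> extensional (topspace (Hspace H X))" "continuous_map (Hspace H X) Y g"
    and "\<And>A. A \<in> Hdc H X \<Longrightarrow> Y closure_of {g (as_point A)} = Y closure_of (f ` A)"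
    and "\<And>x. x \<in> topspace X \<Longrightarrow> g (eta X x) = f x"
proof -
  have "\<forall>A\<in>Hdc H X. \<exists>y. y \<in> topspace Y \<and> Y closure_of (f ` A) = Y closure_of {y}"
    using Y f unfolding Hdc_def H_sober_determined_iff by blast
  then obtain e where e: "\<And>A. A \<in> Hdc H X \<Longrightarrow> e A \<in> topspace Y"
      "\<And>A. A \<in> Hdc H X \<Longrightarrow> Y closure_of (f ` A) = Y closure_of {e A}"
    by metis
  define g where "g = (\<lambda>p\<in>as_point ` Hdc H X. e (inv_into (Hdc H X) as_point p))"
  have g: "g (as_point A) = e A" if "A \<in> Hdc H X" for A
    using that by (simp add: g_def inv_into_f_f[OF as_point_inj])
  show thesis
  proof
    show "g \<in> extensional (topspace (Hspace H X))"
      by (simp add: g_def Hspace_eq)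
    show cl: "Y closure_of {g (as_point A)} = Y closure_of (f ` A)" if "A \<in> Hdc H X" for A
      using e(2)[OF that] g[OF that] by simp
    show "continuous_map (Hspace H X) Y g"
      unfolding continuous_map_def
    proof (intro conjI allI impI)
      show "g \<in> topspace (Hspace H X) \<rightarrow> topspace Y"
        using e(1) g by (auto simp: Hspace_eq)
      fix V assume V: "openin Y V"
      let ?U = "{x \<in> topspace X. f x \<in> V}"
      have "g (as_point A) \<in> V \<longleftrightarrow> A \<inter> ?U \<noteq> {}" if A: "A \<in> Hdc H X" for A
      proof -
        have "{g (as_point A)} \<inter> V \<noteq> {} \<longleftrightarrow> f ` A \<inter> V \<noteq> {}"
          using cl[OF A] V unfolding closure_of_eq_iff_meets by blast
        then show ?thesis using sub_topspace[OF A] by blast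
      qed
      then have "{p \<in> topspace (Hspace H X). g p \<in> V} = as_point ` Diamond (Hdc H X) ?U"
        by (auto simp: Hspace_eq Diamond_def)
      moreover have "openin X ?U" using f V by (rule openin_continuous_map_preimage)
      ultimately show "openin (Hspace H X) {p \<in> topspace (Hspace H X). g p \<in> V}"
        unfolding Hspace_eq openin_PH_iff by blast
    qed
    show "g (eta X x) = f x" if x: "x \<in> topspace X" for x
    proof (rule generic_point_unique)
      show "t0_space Y" using Y by (simp add: H_sober_def)
      note cx = point_closure[OF x]
      show "g (eta X x) \<in> topspace Y" using x e(1)[OF cx] g[OF cx] by (simp add: eta_apply)
      show "f x \<in> topspace Y" using f x by (auto dest: continuous_map_funspace)
      show "Y closure_of {g (eta X x)} = Y closure_of {f x}"
        using cl[OF cx] x closure_of_image_closure_of[OF f, of "{x}"] by (simp add: eta_apply)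
    qed
  qed
qed

text \<open>As \<open>A\<close> is the generic point of \<open>eta X ` A\<close>, continuity forces its image under any extension to
  be the generic point of \<open>f ` A\<close>.\<close>

lemma extension_closure:
  assumes g: "continuous_map (Hspace H X) Y g"
    and ext: "\<And>x. x \<in> topspace X \<Longrightarrow> g (eta X x) = f x" and A: "A \<in> Hdc H X"
  shows "Y closure_of {g (as_point A)} = Y closure_of (f ` A)"
proof -
  have sub: "A \<subseteq> topspace X" using sub_topspace[OF A] .
  have "X closure_of A = A" using closed[OF A] by (simp add: closure_of_eq)
  then have "Hspace H X closure_of (eta X ` A) = Hspace H X closure_of {as_point A}"
    using closure_of_eta_image[OF sub A] by (simp add: Hspace_eq)
  moreover have "eta X ` A \<subseteq> topspace (Hspace H X)"
    using continuous_map_funspace[OF eta_continuous] sub unfolding Hspace_eq by blast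
  ultimately have "Y closure_of (g ` eta X ` A) = Y closure_of (g ` {as_point A})"
    using A by (intro closure_of_image_cong[OF g]) (auto simp: Hspace_eq)
  moreover have "g ` eta X ` A = f ` A"
    using ext sub by (force simp: image_image)
  ultimately show ?thesis by simp
qed

lemma eta_universal:
  assumes Y: "H_sober H Y" and f: "f \<in> Hom Top0 X Y"
  shows "\<exists>!g. g \<in> Hom Top0 (Hspace H X) Y \<and> Comp Top0 X (Hspace H X) Y g (eta X) = f"
proof -
  have fc: "continuous_map X Y f" and fe: "f \<in> extensional (topspace X)" using f by auto
  have comp_iff: "compose (topspace X) g (eta X) = f \<longleftrightarrow> (\<forall>x\<in>topspace X. g (eta X x) = f x)" for g
    using fe by (auto simp: compose_def fun_eq_iff extensional_def)
  obtain g where "g \<in> Hom Top0 (Hspace H X) Y" "\<And>x. x \<in> topspace X \<Longrightarrow> g (eta X x) = f x"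
    using extension_exists[OF Y fc] by (metis Top0_simps(2))
  moreover have "g = g'"
    if g: "g \<in> Hom Top0 (Hspace H X) Y" "\<And>x. x \<in> topspace X \<Longrightarrow> g (eta X x) = f x"
      and g': "g' \<in> Hom Top0 (Hspace H X) Y" "\<And>x. x \<in> topspace X \<Longrightarrow> g' (eta X x) = f x" for g g'
  proof (rule extensionalityI)
    show "g \<in> extensional (topspace (Hspace H X))" "g' \<in> extensional (topspace (Hspace H X))"
      using g(1) g'(1) by simp_all
    fix p assume p: "p \<in> topspace (Hspace H X)"
    then obtain A where A: "A \<in> Hdc H X" "p = as_point A" by (auto simp: Hspace_eq)
    have gc: "continuous_map (Hspace H X) Y g" "continuous_map (Hspace H X) Y g'"
      using g(1) g'(1) by simp_all
    show "g p = g' p"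
    proof (rule generic_point_unique)
      show "t0_space Y" using Y by (simp add: H_sober_def)
      show "g p \<in> topspace Y" "g' p \<in> topspace Y"
        using gc p by (auto dest: continuous_map_funspace)
      show "Y closure_of {g p} = Y closure_of {g' p}"
        using extension_closure[OF gc(1) g(2) A(1)] extension_closure[OF gc(2) g'(2) A(1)] A(2) by simp
    qed
  qed
  ultimately show ?thesis unfolding Top0_simps(4) comp_iff by blast
qed

text \<open>For \<open>S\<close> in \<open>H\<close> of the hyperspace and \<open>f : X \<rightarrow> Y\<close> with extension \<open>g\<close>, the set \<open>g ` S\<close> collects
  generic points of the images of the members of \<open>S\<close>. So it has the same closure as the
  image of their union, and it lies in \<open>H Y\<close>.\<close>

lemma H_sober_Hspace: "H_sober H (Hspace H X)"
proof -
  have "\<exists>p\<in>topspace (Hspace H X). Hspace H X closure_of S = Hspace H X closure_of {p}"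
    if S: "S \<in> Fobj H (Hspace H X)" for S
  proof -
    have "S \<subseteq> topspace (PH X (Hdc H X))"
      using R_subset_systemD(1)[OF H PH_in_Top0] S by (auto simp: irreducible_in_def Hspace_eq)
    then obtain \<S> where \<S>: "\<S> \<subseteq> Hdc H X" "S = as_point ` \<S>"
      by (rule subset_PH_cases)
    have sub: "\<Union>\<S> \<subseteq> topspace X" using \<S>(1) sub_topspace by blast
    have "X closure_of \<Union>\<S> \<in> Hdc H X"
      unfolding Hdc_def H_sober_determined_iff
    proof (intro CollectI conjI allI impI)
      show "closedin X (X closure_of \<Union>\<S>)" by simp
      show "X closure_of \<Union>\<S> \<subseteq> topspace X" by (rule closure_of_subset_topspace)
      fix Y f assume "H_sober H Y \<and> continuous_map X Y f"
      then have Y: "H_sober H Y" and f: "continuous_map X Y f" by auto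
      obtain g where gc: "continuous_map (Hspace H X) Y g"
        and cl: "\<And>A. A \<in> Hdc H X \<Longrightarrow> Y closure_of {g (as_point A)} = Y closure_of (f ` A)"
        using extension_exists[OF Y f] by metis
      have "g ` S \<in> Fobj H Y"
        using R_subset_systemD(2)[OF H PH_in_Top0, of Y g S] Y gc S
        by (simp add: H_sober_def Hspace_eq)
      then obtain y where y: "y \<in> topspace Y" "Y closure_of (g ` S) = Y closure_of {y}"
        using Y unfolding H_sober_def by blast
      have "Y closure_of (g ` S) = Y closure_of (f ` \<Union>\<S>)"
        unfolding closure_of_eq_iff_meets
      proof (intro allI impI)
        fix V assume V: "openin Y V"
        have "g (as_point A) \<in> V \<longleftrightarrow> f ` A \<inter> V \<noteq> {}" if "A \<in> \<S>" for A
          using cl[of A] that \<S>(1) V unfolding closure_of_eq_iff_meets by blast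
        then show "g ` S \<inter> V \<noteq> {} \<longleftrightarrow> f ` \<Union>\<S> \<inter> V \<noteq> {}"
          unfolding \<S>(2) by blast
      qed
      also have "\<dots> = Y closure_of (f ` (X closure_of \<Union>\<S>))"
        using closure_of_image_closure_of[OF f sub] by simp
      finally show "\<exists>y\<in>topspace Y. Y closure_of (f ` (X closure_of \<Union>\<S>)) = Y closure_of {y}"
        using y by auto
    qed
    then show ?thesis
      using closure_of_hyperspace_points[OF \<S>(1)] \<S>(2) by (auto simp: Hspace_eq)
  qed
  then show ?thesis
    unfolding H_sober_def using PH_in_Top0 unfolding Hspace_eq by blast
qed

lemma eta_in_Hom: "eta X \<in> Hom Top0 X (Hspace H X)"
  using eta_continuous by (simp add: Hspace_eq eta_def)

end

section \<open>The reflection functor\<close>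

lemma is_Hmap_ex1:
  assumes H: "R_subset_system H" and "X \<in> Obj Top0" "Y \<in> Obj Top0" "f \<in> Hom Top0 X Y"
  shows "\<exists>!g. is_Hmap H X Y f g"
proof -
  interpret X: H_sobrification H X using assms by unfold_locales
  interpret Y: H_sobrification H Y using assms by unfold_locales
  have "Comp Top0 X Y (Hspace H Y) (eta Y) f \<in> Hom Top0 X (Hspace H Y)"
    using assms(4) Y.eta_in_Hom by (auto intro: continuous_map_compose_topspace)
  from X.eta_universal[OF Y.H_sober_Hspace this] show ?thesis
    unfolding is_Hmap_def .
qed

lemma is_Hmap_Farr_Hs:
  assumes "R_subset_system H" "X \<in> Obj Top0" "Y \<in> Obj Top0" "f \<in> Hom Top0 X Y"
  shows "is_Hmap H X Y f (Farr (Hs H) X Y f)"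
  using theI'[OF is_Hmap_ex1[OF assms]] by (simp add: Hs_def)

text \<open>The map \<open>g\<close> extends \<open>eta Y \<circ> f\<close>, so its value at \<open>A\<close> is the generic point of \<open>eta Y ` f ` A\<close>, and this is
  the closure of \<open>f ` A\<close>.\<close>

lemma is_Hmap_as_point:
  assumes H: "R_subset_system H" and X: "X \<in> Obj Top0" and Y: "Y \<in> Obj Top0"
    and f: "f \<in> Hom Top0 X Y" and g: "is_Hmap H X Y f g" and A: "A \<in> Hdc H X"
  shows "g (as_point A) = as_point (Y closure_of (f ` A))"
proof -
  interpret X: H_sobrification H X using H X by unfold_locales
  interpret Y: H_sobrification H Y using H Y by unfold_locales
  have fc: "continuous_map X Y f" using f by simp
  have gc: "continuous_map (Hspace H X) (Hspace H Y) g"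
    and comp: "compose (topspace X) g (eta X) = compose (topspace X) (eta Y) f"
    using g by (simp_all add: is_Hmap_def)
  have ext: "g (eta X x) = (eta Y \<circ> f) x" if "x \<in> topspace X" for x
    using fun_cong[OF comp, of x] that by (simp add: compose_def)
  have B: "Y closure_of (f ` A) \<in> Hdc H Y" using closure_of_image_in_Hdc[OF fc A] .
  have "f ` A \<subseteq> topspace Y"
    using X.sub_topspace[OF A] fc by (auto dest: continuous_map_funspace)
  then have cl: "Hspace H Y closure_of (eta Y ` f ` A) =
      Hspace H Y closure_of {as_point (Y closure_of (f ` A))}"
    using Y.closure_of_eta_image[OF _ B] by (simp add: Y.Hspace_eq)
  show ?thesis
  proof (rule generic_point_unique)
    show "t0_space (Hspace H Y)" using Y.H_sober_Hspace by (simp add: H_sober_def)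
    show "g (as_point A) \<in> topspace (Hspace H Y)"
      using gc A by (auto dest!: continuous_map_funspace simp: X.Hspace_eq)
    show "as_point (Y closure_of (f ` A)) \<in> topspace (Hspace H Y)"
      using B by (simp add: Y.Hspace_eq)
    show "Hspace H Y closure_of {g (as_point A)} =
      Hspace H Y closure_of {as_point (Y closure_of (f ` A))}"
      using X.extension_closure[OF gc ext A] cl by (simp add: image_comp)
  qed
qed

lemma universal_arrows_eta:
  assumes H: "R_subset_system H"
  shows "universal_arrows (HSob H) Top0 (Hs H) eta"
proof -
  have Fobj: "Fobj (Hs H) X = Hspace H X" for X by (simp add: Hs_def)
  show ?thesis
  proof
    show "subcategory (HSob H) Top0" by (rule subcategory_HSob)
  next
    fix X :: "'a topology" assume X: "X \<in> Obj Top0"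
    interpret H_sobrification H X using H X by unfold_locales
    show "Fobj (Hs H) X \<in> Obj (HSob H)" using H_sober_Hspace by (simp add: Fobj)
    show "eta X \<in> Hom Top0 X (Fobj (Hs H) X)" using eta_in_Hom by (simp only: Fobj)
    fix Y f assume "Y \<in> Obj (HSob H)" "f \<in> Hom Top0 X Y"
    then show "\<exists>!g. g \<in> Hom (HSob H) (Fobj (Hs H) X) Y \<and>
        Comp Top0 X (Fobj (Hs H) X) Y g (eta X) = f"
      unfolding Fobj HSob_simps by (intro eta_universal)
  next
    fix X Y :: "'a topology" and f
    assume "X \<in> Obj Top0" "Y \<in> Obj Top0" "f \<in> Hom Top0 X Y"
    from is_Hmap_Farr_Hs[OF H this]
    show "Farr (Hs H) X Y f \<in> Hom (HSob H) (Fobj (Hs H) X) (Fobj (Hs H) Y)"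
      and "Comp Top0 X (Fobj (Hs H) X) (Fobj (Hs H) Y) (Farr (Hs H) X Y f) (eta X) =
        Comp Top0 X Y (Fobj (Hs H) Y) (eta Y) f"
      unfolding is_Hmap_def Fobj HSob_simps by blast+
  qed
qed

theorem corollary7p21:
  fixes H :: "'u::set_universe subset_functor"
  assumes "R_subset_system H"
  shows "reflective (HSob H) Top0 \<and>
    left_adjoint Top0 (HSob H) (Hs H) inclusion_functor \<and>
    (\<forall>X\<in>Obj Top0. Fobj (Hs H) X = PH X (Hdc H X) \<and> eta X \<in> Hom Top0 X (PH X (Hdc H X))) \<and>
    (\<forall>X\<in>Obj Top0. \<forall>Y\<in>Obj Top0. \<forall>f\<in>Hom Top0 X Y.
       (\<exists>!g. is_Hmap H X Y f g) \<and>
       is_Hmap H X Y f (Farr (Hs H) X Y f) \<and>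
       (\<forall>A\<in>Hdc H X. Farr (Hs H) X Y f (as_point A) = as_point (Y closure_of (f ` A))))"
proof -
  interpret universal_arrows "HSob H" Top0 "Hs H" eta
    by (rule universal_arrows_eta[OF assms])
  have obj: "Fobj (Hs H) X = PH X (Hdc H X)" for X
    by (simp add: Hs_def Hspace_def)
  show ?thesis
  proof (intro conjI ballI)
    show "reflective (HSob H) Top0" by (rule reflective)
    show "left_adjoint Top0 (HSob H) (Hs H) inclusion_functor" by (rule left_adjoint)
  next
    fix X :: "'u topology" assume "X \<in> Obj Top0"
    then show "eta X \<in> Hom Top0 X (PH X (Hdc H X))" using u_in[of X] unfolding obj by blast
    show "Fobj (Hs H) X = PH X (Hdc H X)" by (rule obj)
  next
    fix X Y :: "'u topology" and f
    assume *: "X \<in> Obj Top0" "Y \<in> Obj Top0" "f \<in> Hom Top0 X Y"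
    show "\<exists>!g. is_Hmap H X Y f g" by (rule is_Hmap_ex1[OF assms *])
    show Hmap: "is_Hmap H X Y f (Farr (Hs H) X Y f)" by (rule is_Hmap_Farr_Hs[OF assms *])
    show "Farr (Hs H) X Y f (as_point A) = as_point (Y closure_of (f ` A))"
      if "A \<in> Hdc H X" for A
      by (rule is_Hmap_as_point[OF assms * Hmap that])
  qed
qed

end
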